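(* Let $\nu\ge 0$, $0<\alpha\le 1$, $M>0$, and let $h:[0,\infty)\to\mathbb{R}$ belong to $Lip_M(\alpha)$, i.e. $|h(s)-h(t)|\le M|s-t|^{\alpha}$ for all $s,t\in[0,\infty)$. Then for every integer $n>3$ and every $x\ge 0$, $$\left|T_n(h;x)-h(x)\right|\le M\left(\tau_n(x)\right)^{\alpha/2},$$ where $\tau_n(x)=T_n\big((s-x)^2;x\big)$ (the operator $T_n$ applied to the function $s\mapsto (s-x)^2$ and evaluated at $x$).
   Context: Fix a real $\nu\ge 0$. For $r\in\mathbb{N}_0$ let $$\gamma_\nu(2r)=\frac{2^{2r}\,r!\,\Gamma(r+\nu+1/2)}{\Gamma(\nu+1/2)},\qquad \gamma_\nu(2r+1)=\frac{2^{2r+1}\,r!\,\Gamma(r+\nu+3/2)}{\Gamma(\nu+1/2)},$$ and $e_\nu(x)=\sum_{r=0}^{\infty}\frac{x^r}{\gamma_\nu(r)}$. For an integer $n\ge 1$, $x\ge 0$ and a continuous function $g$ on $[0,\infty)$ for which the integrals exist finitely, define $$T_n(g;x)=\frac{n-1}{e_\nu(nx)}\sum_{r=1}^{\infty}\binom{n+r-2}{r-1}\frac{(nx)^r}{\gamma_\nu(r)}\int_0^\infty s^{r-1}(1+s)^{-n-r+1}g(s)\,ds+\frac{g(0)}{e_\nu(nx)}.$$ *)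

theory Defs
  imports "HOL-Analysis.Analysis"
begin

definition dunkl_gamma :: "real \<Rightarrow> nat \<Rightarrow> real" where
  "dunkl_gamma \<nu> m =
     (let r = m div 2 in
      if even m
      then 2 ^ (2 * r) * fact r * Gamma (real r + \<nu> + 1 / 2) / Gamma (\<nu> + 1 / 2)
      else 2 ^ (2 * r + 1) * fact r * Gamma (real r + \<nu> + 3 / 2) / Gamma (\<nu> + 1 / 2))"

definition dunkl_exp :: "real \<Rightarrow> real \<Rightarrow> real" where
  "dunkl_exp \<nu> x = (\<Sum>r. x ^ r / dunkl_gamma \<nu> r)"

text \<open>
  The series over r = 1, 2, ... is indexed by k = r - 1, i.e. r = Suc k.  The integrals are
  Lebesgue integrals over the half-line, so only the values of g on the half-line matter.
\<close>

definition dunkl_op :: "real \<Rightarrow> nat \<Rightarrow> (real \<Rightarrow> real) \<Rightarrow> real \<Rightarrow> real" where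
  "dunkl_op \<nu> n g x =
     (real n - 1) / dunkl_exp \<nu> (real n * x) *
       (\<Sum>k. let r = Suc k in
          real ((n + r - 2) choose (r - 1)) * ((real n * x) ^ r / dunkl_gamma \<nu> r) *
          (LBINT s:{0..}. s ^ (r - 1) * (1 + s) powi (- int n - int r + 1) * g s))
     + g 0 / dunkl_exp \<nu> (real n * x)"

definition Lip_class :: "real \<Rightarrow> real \<Rightarrow> (real \<Rightarrow> real) set" where
  "Lip_class M \<alpha> =
     {h. \<forall>s\<ge>0. \<forall>t\<ge>0. \<bar>h s - h t\<bar> \<le> M * \<bar>s - t\<bar> powr \<alpha>}"

definition second_moment :: "real \<Rightarrow> nat \<Rightarrow> real \<Rightarrow> real" where
  "second_moment \<nu> n x = dunkl_op \<nu> n (\<lambda>s. (s - x)\<^sup>2) x"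

end

theory Submission
  imports Defs
begin

text \<open>
  The operator \<open>T\<^sub>n\<close> is integration against a probability measure on the half-line: its
  weights are nonnegative, and \<open>T\<^sub>n 1 = 1\<close> because each beta integral
  \<open>\<integral> s\<^sup>k (1+s)\<^sup>-\<^sup>n\<^sup>-\<^sup>k ds = k! (n-2)! / (n+k-1)!\<close> cancels its binomial coefficient up to the
  factor \<open>n - 1\<close>, leaving the series of \<open>e\<^sub>\<nu>(nx)\<close>.  The theorem is then Jensen's inequality for
  the concave function \<open>u \<mapsto> u powr (\<alpha>/2)\<close>:
  \<open>|T\<^sub>n h - h(x)| \<le> M T\<^sub>n |s - x| powr \<alpha> \<le> M (T\<^sub>n (s - x)\<^sup>2) powr (\<alpha>/2)\<close>.

  Jensen's inequality is carried out by hand, which needs of \<open>T\<^sub>n\<close> only that it is monotone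
  (\<open>dunkl_op_mono\<close>) and commutes with affine maps (\<open>dunkl_op_affine\<close>).  The concave function lies
  below its tangent at \<open>\<tau>\<close> (\<open>powr_le_tangent\<close>), so \<open>h\<close> lies between the two functions
  \<open>h(x) \<plusminus> (A (s - x)\<^sup>2 + B)\<close>; applying \<open>T\<^sub>n\<close> and choosing \<open>\<tau> = T\<^sub>n (s - x)\<^sup>2\<close> gives the bound.  The
  choice is legitimate since \<open>\<tau> > 0\<close> for \<open>x > 0\<close>: already the atom at \<open>0\<close> contributes
  \<open>x\<^sup>2 / e\<^sub>\<nu>(nx)\<close>.

  All functions involved are continuous and grow at most quadratically.  For \<open>n > 3\<close> their
  integrals are bounded uniformly in the summation index, so the series converges because
  \<open>\<gamma>\<^sub>\<nu>(m) \<ge> m!\<close>.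
\<close>

section \<open>The coefficients of the Dunkl exponential\<close>

lemma dunkl_gamma_0 [simp]: "\<nu> \<ge> 0 \<Longrightarrow> dunkl_gamma \<nu> 0 = 1"
proof -
  assume "\<nu> \<ge> 0"
  then have "Gamma (\<nu> + 1 / 2) > 0" by (intro Gamma_real_pos) simp
  then show ?thesis by (simp add: dunkl_gamma_def)
qed

lemma dunkl_gamma_Suc:
  assumes "\<nu> \<ge> 0"
  shows "dunkl_gamma \<nu> (Suc m) = (real (Suc m) + (if even m then 2 * \<nu> else 0)) * dunkl_gamma \<nu> m"
proof (cases "even m")
  case True
  then obtain r where m: "m = 2 * r" by (elim evenE)
  have "real r + \<nu> + 1 / 2 \<notin> \<int>\<^sub>\<le>\<^sub>0"
    using assms nonpos_Ints_nonpos by fastforce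
  from Gamma_plus1[OF this]
  have "Gamma (real r + \<nu> + 3 / 2) = (real r + \<nu> + 1 / 2) * Gamma (real r + \<nu> + 1 / 2)"
    by (simp add: algebra_simps)
  then show ?thesis
    by (simp add: dunkl_gamma_def m Let_def)
next
  case False
  then obtain r where m: "m = 2 * r + 1" by (elim oddE)
  have "Suc m = 2 * Suc r" "Suc m div 2 = Suc r" "m div 2 = r" using m by auto
  moreover have "real (Suc r) + \<nu> + 1 / 2 = real r + \<nu> + 3 / 2" by simp
  ultimately show ?thesis
    using False by (simp add: dunkl_gamma_def Let_def m field_simps)
qed

lemma dunkl_gamma_ge_fact:
  assumes "\<nu> \<ge> 0"
  shows "dunkl_gamma \<nu> m \<ge> fact m"
proof (induction m)
  case 0
  then show ?case using assms by simp
next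
  case (Suc m)
  have "real (Suc m) * fact m
      \<le> (real (Suc m) + (if even m then 2 * \<nu> else 0)) * dunkl_gamma \<nu> m"
    using Suc assms by (intro mult_mono) auto
  then show ?case using assms by (simp add: dunkl_gamma_Suc)
qed

lemma dunkl_gamma_pos: "\<nu> \<ge> 0 \<Longrightarrow> dunkl_gamma \<nu> m > 0"
  using dunkl_gamma_ge_fact[of \<nu> m] fact_gt_zero[of m, where 'a = real] by linarith

lemma summable_dunkl_exp:
  assumes "\<nu> \<ge> 0" "y \<ge> 0"
  shows "summable (\<lambda>m. y ^ m / dunkl_gamma \<nu> m)"
proof (rule summable_comparison_test')
  show "summable (\<lambda>m. inverse (fact m) * y ^ m)" by (rule summable_exp)
  show "norm (y ^ m / dunkl_gamma \<nu> m) \<le> inverse (fact m) * y ^ m" for m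
    using dunkl_gamma_ge_fact[of \<nu> m] dunkl_gamma_pos[of \<nu> m] assms
    by (simp add: field_simps mult_right_mono)
qed

lemma dunkl_exp_split_head:
  assumes "\<nu> \<ge> 0" "y \<ge> 0"
  shows "dunkl_exp \<nu> y = (\<Sum>k. y ^ Suc k / dunkl_gamma \<nu> (Suc k)) + 1"
  using suminf_split_head[OF summable_dunkl_exp[OF assms]] assms
  by (simp add: dunkl_exp_def)

lemma dunkl_exp_pos:
  assumes "\<nu> \<ge> 0" "y \<ge> 0"
  shows "dunkl_exp \<nu> y > 0"
proof -
  have "summable (\<lambda>k. y ^ Suc k / dunkl_gamma \<nu> (Suc k))"
    using summable_dunkl_exp[OF assms] by (subst summable_Suc_iff)
  then have "(\<Sum>k. y ^ Suc k / dunkl_gamma \<nu> (Suc k)) \<ge> 0"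
    using assms dunkl_gamma_pos by (intro suminf_nonneg) (auto simp: less_imp_le)
  then show ?thesis using dunkl_exp_split_head[OF assms] by linarith
qed

section \<open>Beta integrals over the half-line\<close>

text \<open>
  Differentiating \<open>s\<^sup>a\<^sup>+\<^sup>1 / (1+s)\<^sup>a\<^sup>+\<^sup>b\<^sup>+\<^sup>2\<close> expresses the integrand for \<open>a + 1\<close> through the one for
  \<open>a\<close>; the boundary terms vanish at both ends.  Carrying an antiderivative with its limit through
  the induction postpones all questions of integrability to a single use of the fundamental
  theorem.
\<close>

lemma beta_antiderivative:
  fixes a b :: nat
  shows "\<exists>F. (\<forall>s\<ge>0. (F has_real_derivative s ^ a / (1 + s) ^ (a + b + 2)) (at s)) \<and> F 0 = 0 \<and>
             (F \<longlongrightarrow> fact a * fact b / fact (a + b + 1)) at_top"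
proof (induction a)
  case 0
  define F where "F = (\<lambda>s::real. (1 - inverse ((1 + s) ^ (b + 1))) / real (b + 1))"
  have "(F has_real_derivative s ^ 0 / (1 + s) ^ (0 + b + 2)) (at s)" if "s \<ge> 0" for s
  proof -
    have nz: "1 + s \<noteq> 0" using that by simp
    have "(F has_real_derivative
      (- (- (real (b + 1) * (1 + s) ^ b * inverse (((1 + s) ^ (b + 1))\<^sup>2)))) / real (b + 1)) (at s)"
      unfolding F_def using nz
      by (auto intro!: derivative_eq_intros simp: power2_eq_square simp del: power_Suc)
    also have "(- (- (real (b + 1) * (1 + s) ^ b * inverse (((1 + s) ^ (b + 1))\<^sup>2)))) / real (b + 1)
        = s ^ 0 / (1 + s) ^ (0 + b + 2)"
      using nz by (simp add: divide_simps power2_eq_square)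
    finally show ?thesis .
  qed
  moreover have "(F \<longlongrightarrow> (1 - 0) / real (b + 1)) at_top"
  proof -
    have "filterlim (\<lambda>s::real. (1 + s) ^ (b + 1)) at_top at_top"
      by (intro filterlim_pow_at_top filterlim_tendsto_add_at_top[OF tendsto_const] filterlim_ident) auto
    then show ?thesis
      unfolding F_def by (intro tendsto_intros tendsto_inverse_0_at_top) auto
  qed
  moreover have "F 0 = 0" by (simp add: F_def)
  moreover have "(1 - 0) / real (b + 1) = fact 0 * fact b / fact (0 + b + 1)"
    by (simp add: divide_simps)
  ultimately show ?case by (intro exI[of _ F]) simp_all
next
  case (Suc a)
  then obtain F where
    F: "\<And>s. s \<ge> 0 \<Longrightarrow> (F has_real_derivative s ^ a / (1 + s) ^ (a + b + 2)) (at s)" and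
    F0: "F 0 = 0" and Flim: "(F \<longlongrightarrow> fact a * fact b / fact (a + b + 1)) at_top"
    by blast
  define B where "B = (\<lambda>s::real. s ^ (a + 1) / (1 + s) ^ (a + b + 2))"
  define G where "G = (\<lambda>s. (real (a + 1) * F s - B s) / real (a + b + 2))"
  have dB: "(B has_real_derivative
      (real (a + 1) * (s ^ a / (1 + s) ^ (a + b + 2))
       - real (a + b + 2) * (s ^ (a + 1) / (1 + s) ^ (a + b + 3)))) (at s)" if "s \<ge> 0" for s
  proof -
    have nz: "1 + s \<noteq> 0" using that by simp
    have "(B has_real_derivative
      ((real (a + 1) * s ^ a) * (1 + s) ^ (a + b + 2)
        - s ^ (a + 1) * (real (a + b + 2) * (1 + s) ^ (a + b + 1)))
        / ((1 + s) ^ (a + b + 2) * (1 + s) ^ (a + b + 2))) (at s)"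
      unfolding B_def using nz
      by (auto intro!: derivative_eq_intros simp del: power_Suc)
    also have "((real (a + 1) * s ^ a) * (1 + s) ^ (a + b + 2)
        - s ^ (a + 1) * (real (a + b + 2) * (1 + s) ^ (a + b + 1)))
        / ((1 + s) ^ (a + b + 2) * (1 + s) ^ (a + b + 2))
      = real (a + 1) * (s ^ a / (1 + s) ^ (a + b + 2))
       - real (a + b + 2) * (s ^ (a + 1) / (1 + s) ^ (a + b + 3))"
    proof -
      have "(1 + s) ^ (a + b + 2) = (1 + s) * (1 + s) ^ (a + b + 1)"
        "(1 + s) ^ (a + b + 3) = (1 + s) * (1 + s) * (1 + s) ^ (a + b + 1)"
        by (simp_all add: numeral_eq_Suc)
      moreover have "(1 + s) ^ (a + b + 1) \<noteq> 0" using nz by simp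
      ultimately show ?thesis
        using nz by (simp add: divide_simps del: power_Suc) (simp add: algebra_simps)
    qed
    finally show ?thesis .
  qed
  have "(G has_real_derivative s ^ Suc a / (1 + s) ^ (Suc a + b + 2)) (at s)" if "s \<ge> 0" for s
  proof -
    have "(G has_real_derivative
       (real (a + 1) * (s ^ a / (1 + s) ^ (a + b + 2)) -
        (real (a + 1) * (s ^ a / (1 + s) ^ (a + b + 2))
       - real (a + b + 2) * (s ^ (a + 1) / (1 + s) ^ (a + b + 3)))) / real (a + b + 2)) (at s)"
      unfolding G_def
      by (intro DERIV_cdivide DERIV_diff DERIV_cmult F dB that)
    then show ?thesis by (simp add: numeral_eq_Suc del: of_nat_Suc of_nat_add)
  qed
  moreover have "G 0 = 0" by (simp add: G_def F0 B_def)
  moreover have "(G \<longlongrightarrow> fact (Suc a) * fact b / fact (Suc a + b + 1)) at_top"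
  proof -
    have "(B \<longlongrightarrow> 0) at_top"
    proof (rule Lim_null_comparison)
      show "\<forall>\<^sub>F s in at_top. norm (B s) \<le> inverse (1 + s)"
        using eventually_ge_at_top[of 0]
      proof eventually_elim
        case (elim s)
        have "s ^ (a + 1) \<le> (1 + s) ^ (a + 1)" using elim by (intro power_mono) auto
        also have "\<dots> \<le> (1 + s) ^ (a + b + 1)" using elim by (intro power_increasing) auto
        finally show ?case using elim by (simp add: B_def divide_simps mult_ac)
      qed
      show "((\<lambda>s. inverse (1 + s)) \<longlongrightarrow> (0::real)) at_top"
        by (intro tendsto_inverse_0_at_top filterlim_tendsto_add_at_top[OF tendsto_const] filterlim_ident)
    qed
    then have "(G \<longlongrightarrow> (real (a + 1) * (fact a * fact b / fact (a + b + 1)) - 0)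
        / real (a + b + 2)) at_top"
      unfolding G_def by (intro tendsto_intros Flim) auto
    also have "(real (a + 1) * (fact a * fact b / fact (a + b + 1)) - 0) / real (a + b + 2)
        = (fact (Suc a) * fact b / fact (Suc a + b + 1) :: real)"
      by (simp add: divide_simps mult_ac)
    finally show ?thesis .
  qed
  ultimately show ?case by blast
qed

lemma
  fixes a b :: nat
  shows set_integrable_beta:
      "set_integrable lborel {0..} (\<lambda>s. s ^ a / (1 + s) ^ (a + b + 2) :: real)" (is ?int)
    and set_integral_beta:
      "(LBINT s:{0..}. s ^ a / (1 + s) ^ (a + b + 2)) = (fact a * fact b / fact (a + b + 1) :: real)"
      (is ?val)
proof -
  let ?f = "\<lambda>s::real. s ^ a / (1 + s) ^ (a + b + 2)"
  let ?J = "fact a * fact b / fact (a + b + 1) :: real"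
  obtain F where
    F: "\<And>s. s \<ge> 0 \<Longrightarrow> (F has_real_derivative ?f s) (at s)" and
    F0: "F 0 = 0" and Flim: "(F \<longlongrightarrow> ?J) at_top"
    using beta_antiderivative[of a b] by blast
  have "(\<integral>\<^sup>+s. ennreal (?f s) * indicator {0..} s \<partial>lborel) = ?J - F 0"
    by (rule nn_integral_FTC_atLeast[OF _ F _ Flim]) auto
  moreover have "(\<integral>\<^sup>+s. ennreal (?f s) * indicator {0..} s \<partial>lborel)
      = (\<integral>\<^sup>+s. ennreal (indicator {0..} s *\<^sub>R ?f s) \<partial>lborel)"
    by (intro nn_integral_cong) (simp split: split_indicator)
  ultimately have nn: "(\<integral>\<^sup>+s. ennreal (indicator {0..} s *\<^sub>R ?f s) \<partial>lborel) = ennreal ?J"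
    using F0 by simp
  have nonneg: "AE s in lborel. 0 \<le> indicator {0..} s *\<^sub>R ?f s"
    by (auto split: split_indicator)
  show ?int
    unfolding set_integrable_def
    by (rule integrableI_nn_integral_finite[OF _ nonneg nn]) measurable
  show ?val
    unfolding set_lebesgue_integral_def
    by (subst integral_eq_nn_integral[OF _ nonneg]) (simp_all only: nn enn2real_ennreal, auto)
qed

section \<open>The operator on functions of at most quadratic growth\<close>

text \<open>
  The growth bound makes all integrals and the series converge absolutely, so the operator is
  linear and monotone on this class, which contains both the Lipschitz functions and \<open>(s - x)\<^sup>2\<close>.
  Continuity supplies measurability.
\<close>

definition quadratic_growth :: "(real \<Rightarrow> real) \<Rightarrow> bool" where
  "quadratic_growth g \<longleftrightarrow> continuous_on {0..} g \<and> (\<exists>C\<ge>0. \<forall>s\<ge>0. \<bar>g s\<bar> \<le> C * (1 + s)\<^sup>2)"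

definition beta_integral :: "nat \<Rightarrow> nat \<Rightarrow> (real \<Rightarrow> real) \<Rightarrow> real" where
  "beta_integral n k g = (LBINT s:{0..}. s ^ k / (1 + s) ^ (n + k) * g s)"

text \<open>The index \<open>k\<close> stands for \<open>r - 1\<close> in the series over \<open>r \<ge> 1\<close>, here and in the integrals above.\<close>

definition dunkl_coeff :: "real \<Rightarrow> nat \<Rightarrow> real \<Rightarrow> nat \<Rightarrow> real" where
  "dunkl_coeff \<nu> n x k =
     real ((n + k - 1) choose k) * ((real n * x) ^ Suc k / dunkl_gamma \<nu> (Suc k))"

lemma dunkl_op_eq:
  "dunkl_op \<nu> n g x =
    ((real n - 1) * (\<Sum>k. dunkl_coeff \<nu> n x k * beta_integral n k g) + g 0)
      / dunkl_exp \<nu> (real n * x)"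
proof -
  have "(LBINT s:{0..}. s ^ k * (1 + s) powi (- int n - int (Suc k) + 1) * g s)
      = beta_integral n k g" for k
    unfolding beta_integral_def
  proof (rule set_lebesgue_integral_cong)
    show "\<forall>s. s \<in> {0..} \<longrightarrow> s ^ k * (1 + s) powi (- int n - int (Suc k) + 1) * g s
        = s ^ k / (1 + s) ^ (n + k) * g s"
    proof (intro allI impI)
      fix s :: real
      have "- int n - int (Suc k) + 1 = - int (n + k)" by simp
      then have "(1 + s) powi (- int n - int (Suc k) + 1) = inverse ((1 + s) ^ (n + k))"
        by (simp only: power_int_minus power_int_of_nat)
      then show "s ^ k * (1 + s) powi (- int n - int (Suc k) + 1) * g s
        = s ^ k / (1 + s) ^ (n + k) * g s" by (simp add: divide_inverse)
    qed
  qed auto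
  then show ?thesis
    by (simp add: dunkl_op_def dunkl_coeff_def Let_def add_divide_distrib numeral_2_eq_2
          del: of_nat_Suc power_Suc)
qed

lemma dunkl_coeff_nonneg: "\<nu> \<ge> 0 \<Longrightarrow> x \<ge> 0 \<Longrightarrow> dunkl_coeff \<nu> n x k \<ge> 0"
  using dunkl_gamma_pos[of \<nu> "Suc k"] by (simp add: dunkl_coeff_def)

text \<open>
  The crude bound of the binomial coefficient by a power of two is harmless: up to a constant, it only rescales the
  argument of the entire function \<open>e\<^sub>\<nu>\<close>.
\<close>

lemma summable_dunkl_coeff:
  assumes "\<nu> \<ge> 0" "x \<ge> 0"
  shows "summable (dunkl_coeff \<nu> n x)"
proof (rule summable_comparison_test')
  let ?y = "2 * (real n * x)"
  show "summable (\<lambda>k. 2 ^ n * (?y ^ Suc k / dunkl_gamma \<nu> (Suc k)))"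
    using summable_dunkl_exp[of \<nu> ?y] assms
    by (intro summable_mult) (subst summable_Suc_iff, simp)
  show "norm (dunkl_coeff \<nu> n x k) \<le> 2 ^ n * (?y ^ Suc k / dunkl_gamma \<nu> (Suc k))" for k
  proof -
    have "(n + k - 1) choose k \<le> 2 ^ (n + k - 1)" by (rule binomial_le_pow2)
    also have "\<dots> \<le> 2 ^ (n + Suc k)" by (intro power_increasing) auto
    finally have "real ((n + k - 1) choose k) \<le> 2 ^ (n + Suc k)"
      by (metis of_nat_le_iff of_nat_numeral of_nat_power)
    moreover have "(real n * x) ^ Suc k / dunkl_gamma \<nu> (Suc k) \<ge> 0"
      using assms dunkl_gamma_pos[of \<nu> "Suc k"] by (simp del: power_Suc)
    ultimately have "dunkl_coeff \<nu> n x k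
        \<le> 2 ^ (n + Suc k) * ((real n * x) ^ Suc k / dunkl_gamma \<nu> (Suc k))"
      unfolding dunkl_coeff_def by (rule mult_right_mono)
    also have "\<dots> = 2 ^ n * (?y ^ Suc k / dunkl_gamma \<nu> (Suc k))"
      by (simp only: power_add power_mult_distrib times_divide_eq_right mult.assoc)
    finally show ?thesis using dunkl_coeff_nonneg[OF assms] by simp
  qed
qed

text \<open>
  This is where \<open>n > 3\<close> enters: against quadratic growth the weight \<open>s\<^sup>k / (1+s)\<^sup>n\<^sup>+\<^sup>k\<close> leaves a
  decay of order \<open>n - 2 \<ge> 2\<close>, uniformly in \<open>k\<close>.
\<close>

lemma beta_weight_le:
  fixes s :: real
  assumes "n > 3" "s \<ge> 0" "\<bar>y\<bar> \<le> C * (1 + s)\<^sup>2"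
  shows "\<bar>s ^ k / (1 + s) ^ (n + k) * y\<bar> \<le> C * (1 / (1 + s)\<^sup>2)"
proof -
  have "C * (1 + s)\<^sup>2 \<ge> 0" using assms(3) by linarith
  then have C: "C \<ge> 0" using assms(2) by (simp add: zero_le_mult_iff)
  have "s ^ k * (1 + s) ^ 4 \<le> (1 + s) ^ k * (1 + s) ^ n"
    using assms by (intro mult_mono power_mono power_increasing) auto
  then have *: "s ^ k / (1 + s) ^ (n + k) * (1 + s)\<^sup>2 \<le> 1 / (1 + s)\<^sup>2"
    using assms by (simp add: divide_simps power_add power_numeral_reduce mult_ac)
  have "\<bar>s ^ k / (1 + s) ^ (n + k) * y\<bar> = s ^ k / (1 + s) ^ (n + k) * \<bar>y\<bar>"
    using assms by (simp add: abs_mult)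
  also have "\<dots> \<le> s ^ k / (1 + s) ^ (n + k) * (C * (1 + s)\<^sup>2)"
    using assms by (intro mult_left_mono) auto
  also have "\<dots> = C * (s ^ k / (1 + s) ^ (n + k) * (1 + s)\<^sup>2)" by simp
  also have "\<dots> \<le> C * (1 / (1 + s)\<^sup>2)" using * C by (rule mult_left_mono)
  finally show ?thesis .
qed

lemma set_integrable_quadratic_decay:
  "set_integrable lborel {0..} (\<lambda>s::real. C * (1 / (1 + s)\<^sup>2))"
  using set_integrable_beta[of 0 0] by (intro set_integrable_mult_right) (simp add: numeral_2_eq_2)

lemma set_integrable_beta_weight:
  assumes "n > 3" "quadratic_growth g"
  shows "set_integrable lborel {0..} (\<lambda>s. s ^ k / (1 + s) ^ (n + k) * g s)"
proof -
  obtain C where C: "C \<ge> 0" "\<And>s. s \<ge> 0 \<Longrightarrow> \<bar>g s\<bar> \<le> C * (1 + s)\<^sup>2"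
    and cont: "continuous_on {0..} g"
    using assms(2) unfolding quadratic_growth_def by blast
  show ?thesis
  proof (rule set_integrable_bound[OF set_integrable_quadratic_decay[of C]])
    have "continuous_on {0..} (\<lambda>s. s ^ k / (1 + s) ^ (n + k) * g s)"
      by (intro continuous_intros cont) auto
    then have "(\<lambda>s. indicat_real {0..} s *\<^sub>R (s ^ k / (1 + s) ^ (n + k) * g s)) \<in> borel_measurable borel"
      by (intro borel_measurable_continuous_on_indicator) simp_all
    then show "set_borel_measurable lborel {0..} (\<lambda>s. s ^ k / (1 + s) ^ (n + k) * g s)"
      unfolding set_borel_measurable_def by (simp only: measurable_lborel2)
    show "AE s in lborel. s \<in> {0..} \<longrightarrow> norm (s ^ k / (1 + s) ^ (n + k) * g s)
        \<le> norm (C * (1 / (1 + s)\<^sup>2))"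
      using beta_weight_le[OF assms(1) _ C(2)] C(1) by auto
  qed
qed

lemma summable_dunkl_op_series:
  assumes "\<nu> \<ge> 0" "x \<ge> 0" "n > 3" "quadratic_growth g"
  shows "summable (\<lambda>k. dunkl_coeff \<nu> n x k * beta_integral n k g)"
proof -
  obtain C where C: "C \<ge> 0" "\<And>s. s \<ge> 0 \<Longrightarrow> \<bar>g s\<bar> \<le> C * (1 + s)\<^sup>2"
    using assms(4) unfolding quadratic_growth_def by blast
  define K where "K = (LBINT s:{0..}. C * (1 / (1 + s)\<^sup>2))"
  have bound: "\<bar>beta_integral n k g\<bar> \<le> K" for k
  proof -
    note int = set_integrable_beta_weight[OF assms(3,4), of k]
    have "\<bar>beta_integral n k g\<bar> \<le> (LBINT s:{0..}. \<bar>s ^ k / (1 + s) ^ (n + k) * g s\<bar>)"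
      using set_integral_norm_bound[OF int] by (simp add: beta_integral_def)
    also have "\<dots> \<le> K"
      unfolding K_def using beta_weight_le[OF assms(3) _ C(2)]
      by (intro set_integral_mono set_integrable_abs int set_integrable_quadratic_decay) auto
    finally show ?thesis .
  qed
  show ?thesis
  proof (rule summable_comparison_test')
    show "summable (\<lambda>k. dunkl_coeff \<nu> n x k * K)"
      by (intro summable_mult2 summable_dunkl_coeff assms)
    show "norm (dunkl_coeff \<nu> n x k * beta_integral n k g) \<le> dunkl_coeff \<nu> n x k * K" for k
      using bound[of k] dunkl_coeff_nonneg[OF assms(1,2), of n k]
      by (simp add: abs_mult mult_left_mono)
  qed
qed

lemma dunkl_op_mono:
  assumes "\<nu> \<ge> 0" "x \<ge> 0" "n > 3" "quadratic_growth f" "quadratic_growth g"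
    and le: "\<And>s. s \<ge> 0 \<Longrightarrow> f s \<le> g s"
  shows "dunkl_op \<nu> n f x \<le> dunkl_op \<nu> n g x"
proof -
  have "beta_integral n k f \<le> beta_integral n k g" for k
    unfolding beta_integral_def
    using assms by (intro set_integral_mono set_integrable_beta_weight mult_left_mono le) auto
  then have "(\<Sum>k. dunkl_coeff \<nu> n x k * beta_integral n k f)
      \<le> (\<Sum>k. dunkl_coeff \<nu> n x k * beta_integral n k g)"
    using assms by (intro suminf_le mult_left_mono summable_dunkl_op_series dunkl_coeff_nonneg) auto
  then show ?thesis
    unfolding dunkl_op_eq using assms dunkl_exp_pos[of \<nu> "real n * x"]
    by (intro divide_right_mono add_mono mult_left_mono le) auto
qed

lemma beta_integral_one:
  assumes "n \<ge> 2"
  shows "(real n - 1) * (dunkl_coeff \<nu> n x k * beta_integral n k (\<lambda>_. 1))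
    = (real n * x) ^ Suc k / dunkl_gamma \<nu> (Suc k)"
proof -
  obtain b where n: "n = b + 2" using assms by (metis le_Suc_ex add.commute)
  have "beta_integral n k (\<lambda>_. 1) = fact k * fact b / fact (k + b + 1)"
    using set_integral_beta[of k b] by (simp add: beta_integral_def n add_ac)
  moreover have "real ((n + k - 1) choose k) = fact (k + b + 1) / (fact k * fact (b + 1))"
    using binomial_fact[of k "k + b + 1", where 'a = real] by (simp add: n add_ac)
  moreover have "(real n - 1) * (fact (k + b + 1) / (fact k * fact (b + 1))
      * (fact k * fact b / fact (k + b + 1))) = (1 :: real)"
    by (simp add: n fact_Suc[of b] divide_simps del: fact_Suc)
  ultimately have "(real n - 1) * (real ((n + k - 1) choose k) * beta_integral n k (\<lambda>_. 1)) = 1"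
    by simp
  then have "(real n - 1) * (real ((n + k - 1) choose k) * beta_integral n k (\<lambda>_. 1))
      * ((real n * x) ^ Suc k / dunkl_gamma \<nu> (Suc k)) = (real n * x) ^ Suc k / dunkl_gamma \<nu> (Suc k)"
    by (simp only: mult_1)
  then show ?thesis
    unfolding dunkl_coeff_def by (simp only: mult_ac)
qed

text \<open>
  For \<open>A = 0\<close> and \<open>B = 1\<close> this is \<open>T\<^sub>n 1 = 1\<close>: after the cancellation in \<open>beta_integral_one\<close> the series and the
  atom at \<open>0\<close> add up to \<open>e\<^sub>\<nu>(nx)\<close>.
\<close>

lemma dunkl_op_affine:
  assumes "\<nu> \<ge> 0" "x \<ge> 0" "n > 3" "quadratic_growth g"
  shows "dunkl_op \<nu> n (\<lambda>s. A * g s + B) x = A * dunkl_op \<nu> n g x + B"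
proof -
  let ?e = "dunkl_exp \<nu> (real n * x)"
  let ?c = "dunkl_coeff \<nu> n x"
  have one: "quadratic_growth (\<lambda>_. 1)"
    unfolding quadratic_growth_def by (auto intro!: exI[of _ 1])
  have "beta_integral n k (\<lambda>s. A * g s + B)
      = A * beta_integral n k g + B * beta_integral n k (\<lambda>_. 1)" for k
  proof -
    note ig = set_integrable_beta_weight[OF assms(3,4), of k]
    note i1 = set_integrable_beta_weight[OF assms(3) one, of k]
    have "beta_integral n k (\<lambda>s. A * g s + B) = (LBINT s:{0..}.
        A * (s ^ k / (1 + s) ^ (n + k) * g s) + B * (s ^ k / (1 + s) ^ (n + k) * 1))"
      unfolding beta_integral_def by (rule arg_cong[where f = "set_lebesgue_integral lborel {0..}"])
        (intro ext, simp add: distrib_left mult.left_commute)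
    also have "\<dots> = A * beta_integral n k g + B * beta_integral n k (\<lambda>_. 1)"
      unfolding beta_integral_def
      by (simp only: set_integral_add(2) set_integral_mult_right set_integrable_mult_right ig i1)
    finally show ?thesis .
  qed
  then have "(\<Sum>k. ?c k * beta_integral n k (\<lambda>s. A * g s + B))
      = (\<Sum>k. A * (?c k * beta_integral n k g) + B * (?c k * beta_integral n k (\<lambda>_. 1)))"
    by (simp add: algebra_simps)
  also have "\<dots> = A * (\<Sum>k. ?c k * beta_integral n k g) + B * (\<Sum>k. ?c k * beta_integral n k (\<lambda>_. 1))"
    using summable_dunkl_op_series[OF assms] summable_dunkl_op_series[OF assms(1-3) one]
    by (simp add: suminf_add[symmetric] suminf_mult summable_mult)
  finally have sum: "(\<Sum>k. ?c k * beta_integral n k (\<lambda>s. A * g s + B)) = \<dots>" .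
  have "(real n - 1) * (\<Sum>k. ?c k * beta_integral n k (\<lambda>_. 1))
      = (\<Sum>k. (real n - 1) * (?c k * beta_integral n k (\<lambda>_. 1)))"
    using summable_dunkl_op_series[OF assms(1-3) one] by (rule suminf_mult[symmetric])
  also have "\<dots> = ?e - 1"
    using assms by (simp add: beta_integral_one dunkl_exp_split_head del: power_Suc)
  finally have total: "(real n - 1) * (\<Sum>k. ?c k * beta_integral n k (\<lambda>_. 1)) = ?e - 1" .
  have "(real n - 1) * (\<Sum>k. ?c k * beta_integral n k (\<lambda>s. A * g s + B)) + (A * g 0 + B)
      = A * ((real n - 1) * (\<Sum>k. ?c k * beta_integral n k g) + g 0)
        + B * ((real n - 1) * (\<Sum>k. ?c k * beta_integral n k (\<lambda>_. 1)) + 1)"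
    unfolding sum by (simp add: algebra_simps)
  also have "\<dots> = A * ((real n - 1) * (\<Sum>k. ?c k * beta_integral n k g) + g 0) + B * ?e"
    unfolding total by simp
  finally have "dunkl_op \<nu> n (\<lambda>s. A * g s + B) x
      = (A * ((real n - 1) * (\<Sum>k. ?c k * beta_integral n k g) + g 0) + B * ?e) / ?e"
    unfolding dunkl_op_eq by (rule arg_cong)
  moreover have "?e \<noteq> 0" using dunkl_exp_pos[of \<nu> "real n * x"] assms by simp
  ultimately show ?thesis
    by (simp only: dunkl_op_eq[of \<nu> n g x] add_divide_distrib[of _ "B * ?e"]
        nonzero_mult_div_cancel_right times_divide_eq_right not_False_eq_True)
qed

lemma dunkl_op_at_0: "\<nu> \<ge> 0 \<Longrightarrow> dunkl_op \<nu> n g 0 = g 0"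
  by (simp add: dunkl_op_eq dunkl_coeff_def dunkl_exp_split_head)

lemma quadratic_growth_second_moment: "quadratic_growth (\<lambda>s. A * (s - x)\<^sup>2 + B)"
  unfolding quadratic_growth_def
proof (intro conjI exI allI impI)
  show "continuous_on {0..} (\<lambda>s. A * (s - x)\<^sup>2 + B)" by (intro continuous_intros)
  show "0 \<le> \<bar>A\<bar> * (1 + \<bar>x\<bar>)\<^sup>2 + \<bar>B\<bar>" by simp
  fix s :: real assume s: "0 \<le> s"
  have "\<bar>s - x\<bar> \<le> (1 + \<bar>x\<bar>) * (1 + s)"
    using s mult_nonneg_nonneg[OF abs_ge_zero[of x] s] unfolding distrib_left distrib_right by linarith
  then have "(s - x)\<^sup>2 \<le> ((1 + \<bar>x\<bar>) * (1 + s))\<^sup>2"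
    using power_mono[of "\<bar>s - x\<bar>" _ 2] by simp
  then have "\<bar>A\<bar> * (s - x)\<^sup>2 \<le> \<bar>A\<bar> * ((1 + \<bar>x\<bar>)\<^sup>2 * (1 + s)\<^sup>2)"
    by (intro mult_left_mono) (auto simp: power_mult_distrib)
  moreover have "\<bar>B\<bar> * 1 \<le> \<bar>B\<bar> * (1 + s)\<^sup>2"
    using s by (intro mult_left_mono) (auto simp: one_le_power)
  moreover have "\<bar>A * (s - x)\<^sup>2 + B\<bar> \<le> \<bar>A\<bar> * (s - x)\<^sup>2 + \<bar>B\<bar>"
    using abs_triangle_ineq[of "A * (s - x)\<^sup>2" B] by (simp add: abs_mult)
  ultimately show "\<bar>A * (s - x)\<^sup>2 + B\<bar> \<le> (\<bar>A\<bar> * (1 + \<bar>x\<bar>)\<^sup>2 + \<bar>B\<bar>) * (1 + s)\<^sup>2"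
    by (simp add: algebra_simps)
qed

lemma second_moment_pos:
  assumes "\<nu> \<ge> 0" "x > 0" "n > 3"
  shows "second_moment \<nu> n x > 0"
proof -
  have "(\<Sum>k. dunkl_coeff \<nu> n x k * beta_integral n k (\<lambda>s. (s - x)\<^sup>2)) \<ge> 0"
  proof (intro suminf_nonneg mult_nonneg_nonneg dunkl_coeff_nonneg)
    show "summable (\<lambda>k. dunkl_coeff \<nu> n x k * beta_integral n k (\<lambda>s. (s - x)\<^sup>2))"
      using summable_dunkl_op_series[of \<nu> x n] quadratic_growth_second_moment[of 1 x 0] assms
      by simp
    show "beta_integral n k (\<lambda>s. (s - x)\<^sup>2) \<ge> 0" for k
      unfolding beta_integral_def set_lebesgue_integral_def
      by (intro integral_nonneg_AE) (auto split: split_indicator)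
  qed (use assms in auto)
  then show ?thesis
    unfolding second_moment_def dunkl_op_eq
    using assms dunkl_exp_pos[of \<nu> "real n * x"]
    by (intro divide_pos_pos add_nonneg_pos mult_nonneg_nonneg) auto
qed

lemma quadratic_growth_Lip_class:
  assumes h: "h \<in> Lip_class M \<alpha>" and "0 < \<alpha>" "\<alpha> \<le> 1" "M > 0"
  shows "quadratic_growth h"
  unfolding quadratic_growth_def
proof (intro conjI exI allI impI)
  have lip: "\<bar>h s - h t\<bar> \<le> M * \<bar>s - t\<bar> powr \<alpha>" if "s \<ge> 0" "t \<ge> 0" for s t
    using h that by (auto simp: Lip_class_def)
  show "continuous_on {0..} h"
    unfolding continuous_on_def
  proof
    fix t :: real assume t: "t \<in> {0..}"
    have "((\<lambda>s. \<bar>s - t\<bar>) \<longlongrightarrow> \<bar>t - t\<bar>) (at t within {0..})" by (intro tendsto_intros)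
    then have "((\<lambda>s. \<bar>s - t\<bar> powr \<alpha>) \<longlongrightarrow> 0) (at t within {0..})"
      using assms by (intro tendsto_zero_powrI[OF _ tendsto_const]) auto
    then have "((\<lambda>s. M * \<bar>s - t\<bar> powr \<alpha>) \<longlongrightarrow> 0) (at t within {0..})"
      by (rule tendsto_mult_right_zero)
    then have "((\<lambda>s. h s - h t) \<longlongrightarrow> 0) (at t within {0..})"
      by (rule Lim_null_comparison[rotated])
        (use t lip in \<open>auto simp: eventually_at_filter intro!: always_eventually\<close>)
    then show "(h \<longlongrightarrow> h t) (at t within {0..})" by (simp only: LIM_zero_iff)
  qed
  show "0 \<le> \<bar>h 0\<bar> + M" using assms by simp
  fix s :: real assume s: "0 \<le> s"
  have "s powr \<alpha> \<le> (1 + s) powr \<alpha>" using s assms by (intro powr_mono2) auto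
  also have "\<dots> \<le> (1 + s) powr 2" using s assms by (intro powr_mono) auto
  finally have "s powr \<alpha> \<le> (1 + s)\<^sup>2" using s by simp
  then have "\<bar>h s - h 0\<bar> \<le> M * (1 + s)\<^sup>2"
    using lip[of s 0] s assms by (simp add: order_trans[OF _ mult_left_mono])
  moreover have "\<bar>h 0\<bar> * 1 \<le> \<bar>h 0\<bar> * (1 + s)\<^sup>2"
    using s by (intro mult_left_mono) (auto simp: one_le_power)
  ultimately show "\<bar>h s\<bar> \<le> (\<bar>h 0\<bar> + M) * (1 + s)\<^sup>2"
    by (simp add: algebra_simps)
qed

section \<open>Jensen's inequality by a tangent line\<close>

text \<open>Young's inequality for \<open>u\<close> and \<open>t\<close> with exponents \<open>\<beta>\<close> and \<open>1 - \<beta>\<close>, divided by \<open>t powr (1 - \<beta>)\<close>.\<close>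

lemma powr_le_tangent:
  fixes u t \<beta> :: real
  assumes "u \<ge> 0" "t > 0" "0 < \<beta>" "\<beta> \<le> 1"
  shows "u powr \<beta> \<le> \<beta> * t powr (\<beta> - 1) * u + (1 - \<beta>) * t powr \<beta>"
proof (cases "u = 0")
  case False
  have "u powr \<beta> * t powr (1 - \<beta>) \<le> \<beta> * u + (1 - \<beta>) * t"
    using assms False by (intro Youngs_inequality_0) auto
  then have "(u powr \<beta> * t powr (1 - \<beta>)) * t powr (\<beta> - 1)
      \<le> (\<beta> * u + (1 - \<beta>) * t) * t powr (\<beta> - 1)"
    by (rule mult_right_mono) simp
  moreover have "t powr (1 - \<beta>) * t powr (\<beta> - 1) = 1"
    using assms by (simp flip: powr_add)
  moreover have "t * t powr (\<beta> - 1) = t powr \<beta>"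
    using assms by (simp add: powr_mult_base)
  ultimately show ?thesis by (simp add: algebra_simps)
qed (use assms in simp)

theorem theorem6:
  fixes \<nu> \<alpha> M x :: real and h :: "real \<Rightarrow> real" and n :: nat
  assumes "\<nu> \<ge> 0" and "0 < \<alpha>" and "\<alpha> \<le> 1" and "M > 0"
    and "h \<in> Lip_class M \<alpha>"
    and "n > 3" and "x \<ge> 0"
  shows "\<bar>dunkl_op \<nu> n h x - h x\<bar> \<le> M * second_moment \<nu> n x powr (\<alpha> / 2)"
proof (cases "x = 0")
  case True
  then show ?thesis using assms by (simp add: dunkl_op_at_0)
next
  case False
  define \<tau> where "\<tau> = second_moment \<nu> n x"
  define \<beta> where "\<beta> = \<alpha> / 2"
  \<comment> \<open>\<open>A\<close> and \<open>B\<close> are \<open>M\<close> times slope and intercept of the tangent to \<open>u powr \<beta>\<close> at \<open>\<tau>\<close>.\<close>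
  define A where "A = M * (\<beta> * \<tau> powr (\<beta> - 1))"
  define B where "B = M * ((1 - \<beta>) * \<tau> powr \<beta>)"
  have \<tau>: "\<tau> > 0" unfolding \<tau>_def using False assms by (intro second_moment_pos) auto
  have \<beta>: "0 < \<beta>" "\<beta> \<le> 1" using assms by (auto simp: \<beta>_def)
  have near: "\<bar>h s - h x\<bar> \<le> A * (s - x)\<^sup>2 + B" if "s \<ge> 0" for s
  proof -
    have "\<bar>h s - h x\<bar> \<le> M * \<bar>s - x\<bar> powr \<alpha>"
      using assms that by (auto simp: Lip_class_def)
    also have "\<bar>s - x\<bar> powr \<alpha> = ((s - x)\<^sup>2) powr \<beta>"
    proof (cases "s = x")
      case False
      have "((s - x)\<^sup>2) powr \<beta> = (\<bar>s - x\<bar> powr 2) powr \<beta>"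
        using False by simp
      then show ?thesis by (simp only: powr_powr \<beta>_def) simp
    qed simp
    also have "M * ((s - x)\<^sup>2) powr \<beta>
        \<le> M * (\<beta> * \<tau> powr (\<beta> - 1) * (s - x)\<^sup>2 + (1 - \<beta>) * \<tau> powr \<beta>)"
      using \<tau> \<beta> assms by (intro mult_left_mono powr_le_tangent) auto
    finally show ?thesis by (simp add: A_def B_def algebra_simps)
  qed
  have moment: "dunkl_op \<nu> n (\<lambda>s. A' * (s - x)\<^sup>2 + B') x = A' * \<tau> + B'" for A' B'
    using dunkl_op_affine[OF assms(1,7,6), of "\<lambda>s. (s - x)\<^sup>2" A' B']
      quadratic_growth_second_moment[of 1 x 0]
    by (simp add: \<tau>_def second_moment_def)
  note gh = quadratic_growth_Lip_class[OF assms(5,2,3,4)]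
  have "dunkl_op \<nu> n h x \<le> A * \<tau> + (B + h x)"
    unfolding moment[symmetric]
    using near by (intro dunkl_op_mono gh quadratic_growth_second_moment assms) (fastforce simp: abs_le_iff)
  moreover have "(- A) * \<tau> + (h x - B) \<le> dunkl_op \<nu> n h x"
    unfolding moment[symmetric]
    using near by (intro dunkl_op_mono gh quadratic_growth_second_moment assms) (fastforce simp: abs_le_iff)
  moreover have "A * \<tau> + B = M * \<tau> powr \<beta>"
  proof -
    have "\<tau> powr (\<beta> - 1) * \<tau> = \<tau> powr \<beta>"
      using \<tau> by (simp add: powr_mult_base mult.commute)
    then have "A * \<tau> = M * (\<beta> * \<tau> powr \<beta>)"
      by (simp only: A_def mult.assoc)
    then show ?thesis by (simp add: B_def algebra_simps)
  qed
  ultimately show ?thesis by (simp add: \<tau>_def \<beta>_def abs_le_iff)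
qed

end
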